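(* Let $(\Omega,\Sigma,\mu)$ be a finite measure space, let $E$ be a faithful solid subalgebra of $L^0(\Omega)$, and let $\mathcal U$ be a unital Banach--Kantorovich algebra over $E$ with unit $e$. For every $x\in\mathcal U$ the set $$\mathrm{sp}(x)=\{a\in E:\ ae-x\ \text{is not invertible in }\mathcal U\}$$ is non-empty.
   Context: **Base algebra.** $L^0(\Omega)$ is the algebra of a.e.-equivalence classes of complex measurable functions on $\Omega$, $L^\infty(\Omega)$ the subalgebra of classes of essentially bounded functions, $\mathbf 1$ the constant function $1$. A faithful solid subalgebra $E\subset L^0(\Omega)$ is a subalgebra such that $x\in L^0(\Omega)$, $y\in E$, $|x|\le|y|$ imply $x\in E$, and $E^\perp=\{0\}$ (only $0$ is disjoint from all of $E$); it is assumed that $L^\infty(\Omega)\subset E\subset L^0(\Omega)$. **Banach--Kantorovich algebras.** An $E$-valued norm on a complex vector space $X$ is a map $\|\cdot\|:X\to E$ with $\|x\|\ge0$; $\|x\|=0\iff x=0$; $\|\lambda x\|=|\lambda|\|x\|$ for $\lambda\in\mathbb C$; $\|x+y\|\le\|x\|+\|y\|$. It is $d$-decomposable if, whenever $\|x\|=\lambda_1+\lambda_2$ with $0\le\lambda_1,\lambda_2\in E$, $\lambda_1\lambda_2=0$, there are $x_1,x_2$ with $x=x_1+x_2$, $\|x_k\|=\lambda_k$. A net $(x_\alpha)$ $(bo)$-converges to $x$ if $\|x-x_\alpha\|\to0$ in order. A Banach--Kantorovich space over $E$ is a space with a $d$-decomposable $E$-valued norm which is complete with respect to $(bo)$-convergence.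 A Banach--Kantorovich algebra over $E$ is a complex algebra $\mathcal U$ that is an $E$-module with $(au)v=a(uv)=u(av)$ ($a\in E$, $u,v\in\mathcal U$), with an $E$-valued norm making it a Banach--Kantorovich space over $E$, with $\|au\|=|a|\|u\|$ and $\|uv\|\le\|u\|\|v\|$. It is unital if it has a unit $e$ with $\|e\|=\mathbf 1$. *)

theory Defs
  imports "HOL-Analysis.Analysis" "HOL-Library.Complex_Order"
begin

section \<open>The algebra of classes of measurable functions\<close>

definition ae_rel :: "'w measure \<Rightarrow> (('w \<Rightarrow> complex) \<times> ('w \<Rightarrow> complex)) set" where
  "ae_rel M = {(f, g). f \<in> borel_measurable M \<and> g \<in> borel_measurable M \<and> (AE w in M. f w = g w)}"

definition L0 :: "'w measure \<Rightarrow> ('w \<Rightarrow> complex) set set" where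
  "L0 M = borel_measurable M // ae_rel M"

definition L0_class :: "'w measure \<Rightarrow> ('w \<Rightarrow> complex) \<Rightarrow> ('w \<Rightarrow> complex) set" where
  "L0_class M f = ae_rel M `` {f}"

definition rep :: "('w \<Rightarrow> complex) set \<Rightarrow> 'w \<Rightarrow> complex" where
  "rep a = (SOME f. f \<in> a)"

text \<open>The operations and the order of \<open>L0 M\<close> are defined pointwise on chosen representatives;
  \<open>L0_ops_class\<close> below shows that they do not depend on the choice.  The order is that
  of \<open>HOL-Library.Complex_Order\<close>: \<open>z \<le> w\<close> iff \<open>w - z\<close> is a nonnegative real number.\<close>

definition L0_const :: "'w measure \<Rightarrow> complex \<Rightarrow> ('w \<Rightarrow> complex) set" where
  "L0_const M c = L0_class M (\<lambda>_. c)"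

definition L0_add :: "'w measure \<Rightarrow> ('w \<Rightarrow> complex) set \<Rightarrow> ('w \<Rightarrow> complex) set \<Rightarrow> ('w \<Rightarrow> complex) set" where
  "L0_add M a b = L0_class M (\<lambda>w. rep a w + rep b w)"

definition L0_diff :: "'w measure \<Rightarrow> ('w \<Rightarrow> complex) set \<Rightarrow> ('w \<Rightarrow> complex) set \<Rightarrow> ('w \<Rightarrow> complex) set" where
  "L0_diff M a b = L0_class M (\<lambda>w. rep a w - rep b w)"

definition L0_mult :: "'w measure \<Rightarrow> ('w \<Rightarrow> complex) set \<Rightarrow> ('w \<Rightarrow> complex) set \<Rightarrow> ('w \<Rightarrow> complex) set" where
  "L0_mult M a b = L0_class M (\<lambda>w. rep a w * rep b w)"

definition L0_scale :: "'w measure \<Rightarrow> complex \<Rightarrow> ('w \<Rightarrow> complex) set \<Rightarrow> ('w \<Rightarrow> complex) set" where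
  "L0_scale M c a = L0_class M (\<lambda>w. c * rep a w)"

definition L0_abs :: "'w measure \<Rightarrow> ('w \<Rightarrow> complex) set \<Rightarrow> ('w \<Rightarrow> complex) set" where
  "L0_abs M a = L0_class M (\<lambda>w. complex_of_real (cmod (rep a w)))"

definition L0_le :: "'w measure \<Rightarrow> ('w \<Rightarrow> complex) set \<Rightarrow> ('w \<Rightarrow> complex) set \<Rightarrow> bool" where
  "L0_le M a b \<longleftrightarrow> (AE w in M. rep a w \<le> rep b w)"

text \<open>Disjointness in the vector lattice sense, i.e. \<open>min \<bar>a\<bar> \<bar>b\<bar> = 0\<close>.\<close>

definition L0_disjoint :: "'w measure \<Rightarrow> ('w \<Rightarrow> complex) set \<Rightarrow> ('w \<Rightarrow> complex) set \<Rightarrow> bool" where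
  "L0_disjoint M a b \<longleftrightarrow> (AE w in M. min (cmod (rep a w)) (cmod (rep b w)) = 0)"

definition Linfty :: "'w measure \<Rightarrow> ('w \<Rightarrow> complex) set set" where
  "Linfty M = {a \<in> L0 M. \<exists>C::real. AE w in M. cmod (rep a w) \<le> C}"

lemma L0_class_in_L0: "f \<in> borel_measurable M \<Longrightarrow> L0_class M f \<in> L0 M"
  by (auto simp: L0_def L0_class_def quotient_def)

lemma L0_cases:
  assumes "a \<in> L0 M"
  obtains f where "f \<in> borel_measurable M" "a = L0_class M f"
  using assms by (auto simp: L0_def L0_class_def quotient_def)

lemma L0_class_eq_iff:
  assumes "f \<in> borel_measurable M" "g \<in> borel_measurable M"
  shows "L0_class M f = L0_class M g \<longleftrightarrow> (AE w in M. f w = g w)"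
proof
  assume "L0_class M f = L0_class M g"
  moreover have "g \<in> L0_class M g" using assms by (auto simp: L0_class_def ae_rel_def)
  ultimately have "g \<in> L0_class M f" by simp
  then show "AE w in M. f w = g w" by (auto simp: L0_class_def ae_rel_def)
next
  assume fg: "AE w in M. f w = g w"
  have "(AE w in M. f w = h w) \<longleftrightarrow> (AE w in M. g w = h w)" for h
  proof
    assume "AE w in M. f w = h w" with fg show "AE w in M. g w = h w" by eventually_elim simp
  next
    assume "AE w in M. g w = h w" with fg show "AE w in M. f w = h w" by eventually_elim simp
  qed
  then show "L0_class M f = L0_class M g"
    using assms by (auto simp: L0_class_def ae_rel_def)
qed

lemma L0_class_eqI:
  assumes "f \<in> borel_measurable M" "g \<in> borel_measurable M" "AE w in M. f w = g w"
  shows "L0_class M f = L0_class M g"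
  using assms by (simp add: L0_class_eq_iff)

lemma rep_L0_class:
  assumes "f \<in> borel_measurable M"
  shows "rep (L0_class M f) \<in> borel_measurable M" "AE w in M. rep (L0_class M f) w = f w"
proof -
  have "f \<in> L0_class M f" using assms by (auto simp: L0_class_def ae_rel_def)
  then have "rep (L0_class M f) \<in> L0_class M f" unfolding rep_def
    by (rule someI[where P = "\<lambda>g. g \<in> L0_class M f"])
  then show "rep (L0_class M f) \<in> borel_measurable M" "AE w in M. rep (L0_class M f) w = f w"
    by (auto simp: L0_class_def ae_rel_def)
qed

lemma L0_ops_class:
  assumes [measurable]: "f \<in> borel_measurable M" "g \<in> borel_measurable M"
  shows "L0_add M (L0_class M f) (L0_class M g) = L0_class M (\<lambda>w. f w + g w)"
    and "L0_diff M (L0_class M f) (L0_class M g) = L0_class M (\<lambda>w. f w - g w)"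
    and "L0_mult M (L0_class M f) (L0_class M g) = L0_class M (\<lambda>w. f w * g w)"
    and "L0_scale M c (L0_class M f) = L0_class M (\<lambda>w. c * f w)"
    and "L0_abs M (L0_class M f) = L0_class M (\<lambda>w. complex_of_real (cmod (f w)))"
    and "L0_le M (L0_class M f) (L0_class M g) \<longleftrightarrow> (AE w in M. f w \<le> g w)"
    and "L0_disjoint M (L0_class M f) (L0_class M g) \<longleftrightarrow> (AE w in M. min (cmod (f w)) (cmod (g w)) = 0)"
    and "L0_class M f \<in> Linfty M \<longleftrightarrow> (\<exists>C. AE w in M. cmod (f w) \<le> C)"
proof -
  note [measurable] = rep_L0_class(1)[OF assms(1)] rep_L0_class(1)[OF assms(2)]
  note eqs = rep_L0_class(2)[OF assms(1)] rep_L0_class(2)[OF assms(2)]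
  show "L0_add M (L0_class M f) (L0_class M g) = L0_class M (\<lambda>w. f w + g w)"
    unfolding L0_add_def by (rule L0_class_eqI, measurable) (use eqs in eventually_elim, simp)
  show "L0_diff M (L0_class M f) (L0_class M g) = L0_class M (\<lambda>w. f w - g w)"
    unfolding L0_diff_def by (rule L0_class_eqI, measurable) (use eqs in eventually_elim, simp)
  show "L0_mult M (L0_class M f) (L0_class M g) = L0_class M (\<lambda>w. f w * g w)"
    unfolding L0_mult_def by (rule L0_class_eqI, measurable) (use eqs in eventually_elim, simp)
  show "L0_scale M c (L0_class M f) = L0_class M (\<lambda>w. c * f w)"
    unfolding L0_scale_def by (rule L0_class_eqI, measurable) (use eqs in eventually_elim, simp)
  show "L0_abs M (L0_class M f) = L0_class M (\<lambda>w. complex_of_real (cmod (f w)))"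
    unfolding L0_abs_def by (rule L0_class_eqI, measurable) (use eqs in eventually_elim, simp)
  have cong: "(AE w in M. P (rep (L0_class M f) w) (rep (L0_class M g) w)) \<longleftrightarrow> (AE w in M. P (f w) (g w))"
    for P :: "complex \<Rightarrow> complex \<Rightarrow> bool"
  proof
    assume "AE w in M. P (rep (L0_class M f) w) (rep (L0_class M g) w)"
    with eqs show "AE w in M. P (f w) (g w)" by eventually_elim simp
  next
    assume "AE w in M. P (f w) (g w)"
    with eqs show "AE w in M. P (rep (L0_class M f) w) (rep (L0_class M g) w)" by eventually_elim simp
  qed
  show "L0_le M (L0_class M f) (L0_class M g) \<longleftrightarrow> (AE w in M. f w \<le> g w)"
    unfolding L0_le_def by (rule cong)
  show "L0_disjoint M (L0_class M f) (L0_class M g) \<longleftrightarrow> (AE w in M. min (cmod (f w)) (cmod (g w)) = 0)"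
    unfolding L0_disjoint_def by (rule cong)
  show "L0_class M f \<in> Linfty M \<longleftrightarrow> (\<exists>C. AE w in M. cmod (f w) \<le> C)"
    unfolding Linfty_def using cong[of "\<lambda>z _. cmod z \<le> C" for C] L0_class_in_L0[OF assms(1)] by simp
qed

locale faithful_solid_subalgebra =
  fixes M :: "'w measure" and E :: "('w \<Rightarrow> complex) set set"
  assumes sub_L0: "E \<subseteq> L0 M"
    and add_closed: "a \<in> E \<Longrightarrow> b \<in> E \<Longrightarrow> L0_add M a b \<in> E"
    and mult_closed: "a \<in> E \<Longrightarrow> b \<in> E \<Longrightarrow> L0_mult M a b \<in> E"
    and scale_closed: "a \<in> E \<Longrightarrow> L0_scale M c a \<in> E"
    and solid: "a \<in> L0 M \<Longrightarrow> b \<in> E \<Longrightarrow> L0_le M (L0_abs M a) (L0_abs M b) \<Longrightarrow> a \<in> E"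
    and faithful: "{a \<in> L0 M. \<forall>b\<in>E. L0_disjoint M a b} = {L0_const M 0}"
    and Linfty_sub: "Linfty M \<subseteq> E"

section \<open>Nets and order convergence\<close>

text \<open>A directed index set: \<open>A\<close> with the relation \<open>le\<close>.\<close>

definition directed_index :: "'i set \<Rightarrow> ('i \<Rightarrow> 'i \<Rightarrow> bool) \<Rightarrow> bool" where
  "directed_index A le \<longleftrightarrow> A \<noteq> {} \<and> (\<forall>i\<in>A. le i i)
     \<and> (\<forall>i\<in>A. \<forall>j\<in>A. \<forall>k\<in>A. le i j \<longrightarrow> le j k \<longrightarrow> le i k)
     \<and> (\<forall>i\<in>A. \<forall>j\<in>A. \<exists>k\<in>A. le i k \<and> le j k)"

text \<open>\<open>D\<close> is (the set of values of) a net in \<open>E\<close> decreasing to \<open>0\<close>, the infimum being taken in \<open>E\<close>.\<close>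

definition decreases_to_zero ::
    "'w measure \<Rightarrow> ('w \<Rightarrow> complex) set set \<Rightarrow> ('w \<Rightarrow> complex) set set \<Rightarrow> bool" where
  "decreases_to_zero M E D \<longleftrightarrow> D \<subseteq> E \<and> D \<noteq> {}
     \<and> (\<forall>c\<in>D. \<forall>d\<in>D. \<exists>b\<in>D. L0_le M b c \<and> L0_le M b d)
     \<and> (\<forall>d\<in>D. L0_le M (L0_const M 0) d)
     \<and> (\<forall>b\<in>E. (\<forall>d\<in>D. L0_le M b d) \<longrightarrow> L0_le M b (L0_const M 0))"

text \<open>Order convergence of the net \<open>z\<close> to \<open>l\<close>: there is a net decreasing to \<open>0\<close>
  each of whose members eventually dominates \<open>\<bar>z i - l\<bar>\<close>.\<close>

definition o_converges ::
    "'w measure \<Rightarrow> ('w \<Rightarrow> complex) set set \<Rightarrow> 'i set \<Rightarrow> ('i \<Rightarrow> 'i \<Rightarrow> bool)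
      \<Rightarrow> ('i \<Rightarrow> ('w \<Rightarrow> complex) set) \<Rightarrow> ('w \<Rightarrow> complex) set \<Rightarrow> bool" where
  "o_converges M E A le z l \<longleftrightarrow>
     (\<exists>D. decreases_to_zero M E D \<and>
        (\<forall>d\<in>D. \<exists>i\<in>A. \<forall>j\<in>A. le i j \<longrightarrow> L0_le M (L0_abs M (L0_diff M (z j) l)) d))"

definition bo_converges ::
    "'w measure \<Rightarrow> ('w \<Rightarrow> complex) set set \<Rightarrow> ('u::ab_group_add \<Rightarrow> ('w \<Rightarrow> complex) set)
      \<Rightarrow> 'i set \<Rightarrow> ('i \<Rightarrow> 'i \<Rightarrow> bool) \<Rightarrow> ('i \<Rightarrow> 'u) \<Rightarrow> 'u \<Rightarrow> bool" where
  "bo_converges M E nrm A le X x \<longleftrightarrow>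
     o_converges M E A le (\<lambda>i. nrm (x - X i)) (L0_const M 0)"

definition bo_Cauchy ::
    "'w measure \<Rightarrow> ('w \<Rightarrow> complex) set set \<Rightarrow> ('u::ab_group_add \<Rightarrow> ('w \<Rightarrow> complex) set)
      \<Rightarrow> 'i set \<Rightarrow> ('i \<Rightarrow> 'i \<Rightarrow> bool) \<Rightarrow> ('i \<Rightarrow> 'u) \<Rightarrow> bool" where
  "bo_Cauchy M E nrm A le X \<longleftrightarrow>
     o_converges M E (A \<times> A) (\<lambda>p q. le (fst p) (fst q) \<and> le (snd p) (snd q))
       (\<lambda>p. nrm (X (fst p) - X (snd p))) (L0_const M 0)"

text \<open>A definition cannot quantify over the type of indices.  Index sets contained in
  \<open>'u set \<times> 'u\<close> suffice: by \<open>bo_complete_any_index\<close>, completeness for these nets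
  implies it for nets with indices of an arbitrary type.\<close>

definition bo_complete ::
    "'w measure \<Rightarrow> ('w \<Rightarrow> complex) set set \<Rightarrow> ('u::ab_group_add \<Rightarrow> ('w \<Rightarrow> complex) set) \<Rightarrow> bool" where
  "bo_complete M E nrm \<longleftrightarrow>
     (\<forall>(A :: ('u set \<times> 'u) set) le X. directed_index A le \<longrightarrow> bo_Cauchy M E nrm A le X
        \<longrightarrow> (\<exists>x. bo_converges M E nrm A le X x))"

lemma bo_complete_any_index:
  fixes X :: "'i \<Rightarrow> 'u::ab_group_add"
  assumes compl: "bo_complete M E nrm" and dir: "directed_index A le" and C: "bo_Cauchy M E nrm A le X"
  shows "\<exists>x. bo_converges M E nrm A le X x"
proof -
  define T where "T i = X ` {j \<in> A. le i j}" for i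
  define B where "B = {(S, u). u \<in> S \<and> (\<exists>i\<in>A. S = T i)}"
  define le' where "le' p q \<longleftrightarrow> fst q \<subseteq> fst p" for p q :: "'u set \<times> 'u"
  have refl: "le i i" if "i \<in> A" for i
    using dir that by (auto simp: directed_index_def)
  have trans: "le i k" if "i \<in> A" "j \<in> A" "k \<in> A" "le i j" "le j k" for i j k
    using dir that unfolding directed_index_def by blast
  have up: "\<exists>k\<in>A. le i k \<and> le j k" if "i \<in> A" "j \<in> A" for i j
    using dir that unfolding directed_index_def by blast
  have inB: "(T i, X i) \<in> B" if "i \<in> A" for i
    using that refl by (auto simp: B_def T_def)
  have Tmono: "T j \<subseteq> T i" if "i \<in> A" "j \<in> A" "le i j" for i j
    unfolding T_def
  proof (rule image_mono, rule subsetI)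
    fix k assume "k \<in> {k \<in> A. le j k}"
    then show "k \<in> {k \<in> A. le i k}" using trans[OF that(1,2) _ that(3)] by simp
  qed
  have "directed_index B le'"
    unfolding directed_index_def
  proof (intro conjI ballI impI)
    obtain i where "i \<in> A" using dir unfolding directed_index_def by blast
    then show "B \<noteq> {}" using inB by blast
    show "le' p p" for p by (simp add: le'_def)
    show "le' p r" if "le' p q" "le' q r" for p q r using that by (auto simp: le'_def)
    fix p q assume "p \<in> B" "q \<in> B"
    then obtain i j where ij: "i \<in> A" "fst p = T i" "j \<in> A" "fst q = T j" by (auto simp: B_def)
    then obtain k where k: "k \<in> A" "le i k" "le j k" using up by blast
    then show "\<exists>r\<in>B. le' p r \<and> le' q r"
      using ij inB[OF k(1)] Tmono[OF ij(1) k(1,2)] Tmono[OF ij(3) k(1,3)]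
      by (intro bexI[of _ "(T k, X k)"]) (simp_all add: le'_def)
  qed
  moreover have "bo_Cauchy M E nrm B le' snd"
  proof -
    obtain D where D: "decreases_to_zero M E D"
      and ev: "\<And>d. d \<in> D \<Longrightarrow> \<exists>p\<in>A \<times> A. \<forall>q\<in>A \<times> A. le (fst p) (fst q) \<and> le (snd p) (snd q) \<longrightarrow>
        L0_le M (L0_abs M (L0_diff M (nrm (X (fst q) - X (snd q))) (L0_const M 0))) d"
      using C unfolding bo_Cauchy_def o_converges_def by blast
    have "\<exists>p\<in>B \<times> B. \<forall>q\<in>B \<times> B. le' (fst p) (fst q) \<and> le' (snd p) (snd q) \<longrightarrow>
        L0_le M (L0_abs M (L0_diff M (nrm (snd (fst q) - snd (snd q))) (L0_const M 0))) d"
      if "d \<in> D" for d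
    proof -
      obtain i1 i2 where i: "i1 \<in> A" "i2 \<in> A"
        and *: "\<And>j1 j2. j1 \<in> A \<Longrightarrow> j2 \<in> A \<Longrightarrow> le i1 j1 \<Longrightarrow> le i2 j2 \<Longrightarrow>
          L0_le M (L0_abs M (L0_diff M (nrm (X j1 - X j2)) (L0_const M 0))) d"
      proof -
        from ev[OF \<open>d \<in> D\<close>] obtain p where p: "p \<in> A \<times> A"
          and *: "\<forall>q\<in>A \<times> A. le (fst p) (fst q) \<and> le (snd p) (snd q) \<longrightarrow>
            L0_le M (L0_abs M (L0_diff M (nrm (X (fst q) - X (snd q))) (L0_const M 0))) d" ..
        show thesis
        proof (rule that)
          show "fst p \<in> A" "snd p \<in> A" using p by (simp_all add: mem_Times_iff)
          fix j1 j2 assume "j1 \<in> A" "j2 \<in> A" "le (fst p) j1" "le (snd p) j2"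
          then show "L0_le M (L0_abs M (L0_diff M (nrm (X j1 - X j2)) (L0_const M 0))) d"
            using *[THEN bspec, of "(j1, j2)"] by simp
        qed
      qed
      show ?thesis
      proof (intro bexI[of _ "((T i1, X i1), (T i2, X i2))"] ballI impI)
        fix q assume q: "q \<in> B \<times> B"
          and "le' (fst ((T i1, X i1), (T i2, X i2))) (fst q) \<and>
            le' (snd ((T i1, X i1), (T i2, X i2))) (snd q)"
        then have "snd (fst q) \<in> T i1" "snd (snd q) \<in> T i2"
          by (auto simp: le'_def B_def)
        then show "L0_le M (L0_abs M (L0_diff M (nrm (snd (fst q) - snd (snd q))) (L0_const M 0))) d"
          using * by (auto simp: T_def)
      qed (use i inB in auto)
    qed
    with D show ?thesis
      unfolding bo_Cauchy_def o_converges_def by (intro exI[of _ D] conjI ballI)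
  qed
  ultimately obtain x where "bo_converges M E nrm B le' snd x"
    using compl unfolding bo_complete_def by blast
  then obtain D where D: "decreases_to_zero M E D"
    and ev: "\<And>d. d \<in> D \<Longrightarrow> \<exists>p\<in>B. \<forall>q\<in>B. le' p q \<longrightarrow>
      L0_le M (L0_abs M (L0_diff M (nrm (x - snd q)) (L0_const M 0))) d"
    unfolding bo_converges_def o_converges_def by blast
  have "\<exists>i\<in>A. \<forall>j\<in>A. le i j \<longrightarrow>
      L0_le M (L0_abs M (L0_diff M (nrm (x - X j)) (L0_const M 0))) d" if "d \<in> D" for d
  proof -
    obtain p where p: "p \<in> B" and *: "\<And>q. q \<in> B \<Longrightarrow> le' p q \<Longrightarrow>
        L0_le M (L0_abs M (L0_diff M (nrm (x - snd q)) (L0_const M 0))) d"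
      using ev[OF \<open>d \<in> D\<close>] by blast
    obtain i where i: "i \<in> A" "fst p = T i" using p by (auto simp: B_def)
    have "L0_le M (L0_abs M (L0_diff M (nrm (x - X j)) (L0_const M 0))) d" if "j \<in> A" "le i j" for j
      using *[OF inB[OF \<open>j \<in> A\<close>]] Tmono[OF i(1) that] i(2) by (simp add: le'_def)
    then show ?thesis using i(1) by blast
  qed
  with D show ?thesis
    unfolding bo_converges_def o_converges_def by (intro exI[of _ x] exI[of _ D] conjI ballI)
qed

section \<open>Banach--Kantorovich spaces and algebras\<close>

locale banach_kantorovich_space = vector_space scaleC
  for scaleC :: "complex \<Rightarrow> 'u::ab_group_add \<Rightarrow> 'u" +
  fixes M :: "'w measure" and E :: "('w \<Rightarrow> complex) set set"
    and nrm :: "'u \<Rightarrow> ('w \<Rightarrow> complex) set"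
  assumes nrm_in: "nrm x \<in> E"
    and nrm_nonneg: "L0_le M (L0_const M 0) (nrm x)"
    and nrm_eq_zero: "nrm x = L0_const M 0 \<longleftrightarrow> x = 0"
    and nrm_scale: "nrm (scaleC c x) = L0_scale M (complex_of_real (cmod c)) (nrm x)"
    and nrm_triangle: "L0_le M (nrm (x + y)) (L0_add M (nrm x) (nrm y))"
    and d_decomposable: "a \<in> E \<Longrightarrow> b \<in> E \<Longrightarrow>
      L0_le M (L0_const M 0) a \<Longrightarrow> L0_le M (L0_const M 0) b \<Longrightarrow>
      L0_mult M a b = L0_const M 0 \<Longrightarrow> nrm x = L0_add M a b \<Longrightarrow>
      \<exists>y z. x = y + z \<and> nrm y = a \<and> nrm z = b"
    and complete: "bo_complete M E nrm"

text \<open>The \<open>E\<close>-module structure is given by \<open>act\<close>, of which only the values on \<open>E\<close> matter.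
  Agreement of the complex scalars with the action of constant classes is not required.\<close>

locale banach_kantorovich_algebra = banach_kantorovich_space scaleC M E nrm
  for scaleC :: "complex \<Rightarrow> 'u::ring \<Rightarrow> 'u"
    and M :: "'w measure" and E :: "('w \<Rightarrow> complex) set set"
    and nrm :: "'u \<Rightarrow> ('w \<Rightarrow> complex) set" +
  fixes act :: "('w \<Rightarrow> complex) set \<Rightarrow> 'u \<Rightarrow> 'u"
  assumes scaleC_mult_left: "scaleC c u * v = scaleC c (u * v)"
    and scaleC_mult_right: "u * scaleC c v = scaleC c (u * v)"
    and act_add_right: "a \<in> E \<Longrightarrow> act a (u + v) = act a u + act a v"
    and act_add_left: "a \<in> E \<Longrightarrow> b \<in> E \<Longrightarrow> act (L0_add M a b) u = act a u + act b u"
    and act_act: "a \<in> E \<Longrightarrow> b \<in> E \<Longrightarrow> act (L0_mult M a b) u = act a (act b u)"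
    and act_one: "act (L0_const M 1) u = u"
    and act_mult_left: "a \<in> E \<Longrightarrow> act a u * v = act a (u * v)"
    and act_mult_right: "a \<in> E \<Longrightarrow> u * act a v = act a (u * v)"
    and nrm_act: "a \<in> E \<Longrightarrow> nrm (act a u) = L0_mult M (L0_abs M a) (nrm u)"
    and nrm_mult: "L0_le M (nrm (u * v)) (L0_mult M (nrm u) (nrm v))"

locale unital_banach_kantorovich_algebra = banach_kantorovich_algebra scaleC M E nrm act
  for scaleC :: "complex \<Rightarrow> 'u::ring \<Rightarrow> 'u"
    and M :: "'w measure" and E :: "('w \<Rightarrow> complex) set set"
    and nrm :: "'u \<Rightarrow> ('w \<Rightarrow> complex) set"
    and act :: "('w \<Rightarrow> complex) set \<Rightarrow> 'u \<Rightarrow> 'u" +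
  fixes e :: 'u
  assumes unit_left: "e * u = u" and unit_right: "u * e = u"
    and nrm_unit: "nrm e = L0_const M 1"

definition invertible_wrt :: "'u::ring \<Rightarrow> 'u \<Rightarrow> bool" where
  "invertible_wrt e u \<longleftrightarrow> (\<exists>v. u * v = e \<and> v * u = e)"

definition sp ::
    "('w \<Rightarrow> complex) set set \<Rightarrow> (('w \<Rightarrow> complex) set \<Rightarrow> 'u::ring \<Rightarrow> 'u) \<Rightarrow> 'u \<Rightarrow> 'u
      \<Rightarrow> ('w \<Rightarrow> complex) set set" where
  "sp E act e x = {a \<in> E. \<not> invertible_wrt e (act a e - x)}"

end

theory Submission
  imports Defs
begin

text \<open>For almost every point \<open>w\<close> the real numbers \<open>\<parallel>u\<parallel>(w)\<close> form a submultiplicative seminorm on any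
  prescribed countable set of elements \<open>u\<close>.  If every \<open>q e - x\<close> with constant \<open>q\<close> has an inverse
  \<open>R q\<close>, then Rickart's elementary proof of the Gelfand theorem, applied at \<open>w\<close>, shows that
  \<open>\<parallel>R q\<parallel>(w)\<close> is unbounded for \<open>q\<close> in a countable dense subset of a disc of radius \<open>\<parallel>x\<parallel>(w) + 1\<close>.
  A measurable choice of points \<open>a(w)\<close> near which it blows up gives an element \<open>a\<close> of \<open>E\<close>.  An inverse
  of \<open>a e - x\<close> would, by the resolvent identity, keep \<open>\<parallel>R q\<parallel>(w)\<close> bounded for \<open>q\<close> near \<open>a(w)\<close>.\<close>

section \<open>Resolvents in seminormed algebras\<close>

text \<open>A countable set of scalars, closed under what Rickart's argument needs: multiplying rational
  radii by roots of unity.\<close>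

definition polar_rats :: "complex set" where
  "polar_rats = (\<lambda>(r, t). of_real r * cis (2 * pi * t)) ` (\<rat> \<times> \<rat>)"

lemma polar_ratsI: "r \<in> \<rat> \<Longrightarrow> t \<in> \<rat> \<Longrightarrow> complex_of_real r * cis (2 * pi * t) \<in> polar_rats"
  unfolding polar_rats_def by (rule image_eqI[where x = "(r, t)"]) auto

lemma countable_polar_rats: "countable polar_rats"
  unfolding polar_rats_def by (intro countable_image countable_SIGMA countable_rat)

lemma of_real_polar_rats: "r \<in> \<rat> \<Longrightarrow> complex_of_real r \<in> polar_rats"
  using polar_ratsI[of r 0] by simp

text \<open>A geometric sum: its ratio \<open>cis (2 * pi * (m / n))\<close> is an
  \<open>n\<close>-th root of unity, and equals 1 only if \<open>n\<close> divides \<open>m\<close>.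
  The range of \<open>m\<close> is that of the exponents \<open>n - j\<close> with
  \<open>j < n\<close>.\<close>

lemma sum_powers_unity_roots:
  assumes "0 < m" "m \<le> n"
  shows "(\<Sum>k<n. cis (2 * pi * (real k / real n)) ^ m) = (if m = n then of_nat n else 0)"
proof -
  define z where "z = cis (2 * pi * (real m / real n))"
  have n: "n > 0" using assms by simp
  have pow: "cis (2 * pi * (real k / real n)) ^ m = z ^ k" for k
  proof -
    have "real m * (2 * pi * (real k / real n)) = real k * (2 * pi * (real m / real n))" by simp
    then show ?thesis by (simp only: z_def Complex.DeMoivre)
  qed
  show ?thesis
  proof (cases "m = n")
    case True
    then have "z = 1" using n by (simp add: z_def)
    then show ?thesis unfolding pow using True by simp
  next
    case False
    have "z = exp (2 * of_real pi * \<i> * of_nat m / of_nat n)"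
      unfolding z_def cis_conv_exp by (simp add: mult_ac)
    then have "z = 1 \<longleftrightarrow> n dvd m"
      using n complex_root_unity_eq_1[of n m] by simp
    then have "z \<noteq> 1" using assms False by (auto dest: dvd_imp_le)
    moreover have "z ^ n = 1"
    proof -
      have "real n * (2 * pi * (real m / real n)) = 2 * pi * real m" using n by simp
      then show ?thesis by (simp only: z_def Complex.DeMoivre) (simp add: cis_multiple_2pi)
    qed
    ultimately show ?thesis using False unfolding pow by (simp add: geometric_sum)
  qed
qed

text \<open>The algebra laws hold for all elements, but the laws of \<open>p\<close> only on
  \<open>C\<close> and for scalars in \<open>polar_rats\<close>. Both sets are countable in the
  application, where each law of \<open>p\<close> is available only off a null set that depends on
  the elements involved.\<close>

locale seminormed_algebra = module s
  for s :: "complex \<Rightarrow> 'u::ring \<Rightarrow> 'u" +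
  fixes e :: 'u and C :: "'u set" and p :: "'u \<Rightarrow> real"
  assumes s_mult_left: "s c u * v = s c (u * v)"
    and s_mult_right: "u * s c v = s c (u * v)"
    and unit_left: "e * u = u" and unit_right: "u * e = u"
    and unit_in: "e \<in> C"
    and add_in: "u \<in> C \<Longrightarrow> v \<in> C \<Longrightarrow> u + v \<in> C"
    and mult_in: "u \<in> C \<Longrightarrow> v \<in> C \<Longrightarrow> u * v \<in> C"
    and scale_in: "q \<in> polar_rats \<Longrightarrow> u \<in> C \<Longrightarrow> s q u \<in> C"
    and p_nonneg: "u \<in> C \<Longrightarrow> 0 \<le> p u"
    and p_add: "u \<in> C \<Longrightarrow> v \<in> C \<Longrightarrow> p (u + v) \<le> p u + p v"
    and p_mult: "u \<in> C \<Longrightarrow> v \<in> C \<Longrightarrow> p (u * v) \<le> p u * p v"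
    and p_scale: "q \<in> polar_rats \<Longrightarrow> u \<in> C \<Longrightarrow> p (s q u) = cmod q * p u"
    and p_unit: "p e = 1"
begin

section \<open>Closure of the carrier, elementary seminorm rules, powers\<close>

lemma uminus_in: "u \<in> C \<Longrightarrow> - u \<in> C"
  using scale_in[of "-1" u] of_real_polar_rats[of "-1"] by simp

lemma diff_in: "u \<in> C \<Longrightarrow> v \<in> C \<Longrightarrow> u - v \<in> C"
  using add_in[of u "- v"] uminus_in[of v] by simp

lemma zero_in: "0 \<in> C"
  using diff_in[OF unit_in unit_in] by simp

lemma sum_in: "(\<And>i. i \<in> I \<Longrightarrow> f i \<in> C) \<Longrightarrow> sum f I \<in> C"
  by (induction I rule: infinite_finite_induct) (auto intro: zero_in add_in)

lemma p_uminus: "u \<in> C \<Longrightarrow> p (- u) = p u"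
  using p_scale[of "-1" u] of_real_polar_rats[of "-1"] by simp

lemma p_diff: "u \<in> C \<Longrightarrow> v \<in> C \<Longrightarrow> p (u - v) \<le> p u + p v"
  using p_add[of u "- v"] uminus_in[of v] p_uminus[of v] by simp

lemma p_zero: "p 0 = 0"
  using p_scale[of 0 e] of_real_polar_rats[of 0] unit_in by simp

lemma p_sum: "(\<And>i. i \<in> I \<Longrightarrow> f i \<in> C) \<Longrightarrow> p (sum f I) \<le> (\<Sum>i\<in>I. p (f i))"
proof (induction I rule: infinite_finite_induct)
  case (insert i I)
  then show ?case using p_add[of "f i" "sum f I"] sum_in[of I f] by fastforce
qed (auto simp: p_zero)

text \<open>The type class \<open>ring\<close> has no unit, so powers are iterated multiplications
  starting from \<open>e\<close>.\<close>

definition pw :: "'u \<Rightarrow> nat \<Rightarrow> 'u" where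
  "pw x n = ((*) x ^^ n) e"

lemma pw_0 [simp]: "pw x 0 = e" and pw_Suc: "pw x (Suc n) = x * pw x n"
  by (simp_all add: pw_def)

lemma pw_Suc2: "pw x (Suc n) = pw x n * x"
proof (induction n)
  case 0 then show ?case by (simp add: pw_Suc unit_left unit_right)
next
  case (Suc n)
  then show ?case by (metis pw_Suc mult.assoc)
qed

lemma pw_in: "x \<in> C \<Longrightarrow> pw x n \<in> C"
  by (induction n) (auto simp: pw_Suc unit_in mult_in)

lemma p_pw: "x \<in> C \<Longrightarrow> p (pw x n) \<le> p x ^ n"
proof (induction n)
  case (Suc n)
  have "p (pw x (Suc n)) \<le> p x * p (pw x n)"
    using p_mult[of x "pw x n"] Suc pw_in by (simp add: pw_Suc)
  also have "\<dots> \<le> p x * p x ^ n" using Suc p_nonneg by (intro mult_left_mono) auto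
  finally show ?case by simp
qed (simp add: p_unit)

text \<open>This is the factorization of \<open>\<mu>^n - x^n\<close> by \<open>\<mu> - x\<close>,
  with \<open>r\<close> cancelling the second factor. The additional factor \<open>\<mu>\<close> is
  the weight of the node in \<open>cauchy_mean\<close>. In the induction, \<open>pw_Suc2\<close>
  puts the new factor on the right, where it meets \<open>r\<close>.\<close>

lemma resolvent_geometric:
  assumes "(s \<mu> e - x) * r = e"
  shows "s \<mu> ((s (\<mu> ^ n) e - pw x n) * r) = (\<Sum>j<n. s (\<mu> ^ (n - j)) (pw x j))"
proof (induction n)
  case (Suc n)
  have "s (\<mu> ^ Suc n) e - pw x (Suc n) = s \<mu> (s (\<mu> ^ n) e - pw x n) + pw x n * (s \<mu> e - x)"
    by (simp add: pw_Suc2 algebra_simps s_mult_right unit_right scale_scale scale_right_diff_distrib)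
  then have "(s (\<mu> ^ Suc n) e - pw x (Suc n)) * r = s \<mu> ((s (\<mu> ^ n) e - pw x n) * r) + pw x n"
    using assms by (simp add: distrib_right s_mult_left mult.assoc unit_right)
  also have "\<dots> = (\<Sum>j<n. s (\<mu> ^ (n - j)) (pw x j)) + pw x n" by (simp add: Suc)
  finally have "s \<mu> ((s (\<mu> ^ Suc n) e - pw x (Suc n)) * r)
      = (\<Sum>j<n. s (\<mu> * \<mu> ^ (n - j)) (pw x j)) + s \<mu> (pw x n)"
    by (simp add: scale_right_distrib scale_sum_right scale_scale)
  also have "(\<Sum>j<n. s (\<mu> * \<mu> ^ (n - j)) (pw x j)) = (\<Sum>j<n. s (\<mu> ^ (Suc n - j)) (pw x j))"
    by (intro sum.cong) (auto simp: Suc_diff_le)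
  finally show ?case by simp
qed (simp add: unit_left)

text \<open>A Riemann sum for the Cauchy integral of the resolvent \<open>R\<close> over the circle of radius \<open>l\<close>.\<close>

definition cauchy_mean :: "(complex \<Rightarrow> 'u) \<Rightarrow> nat \<Rightarrow> real \<Rightarrow> 'u" where
  "cauchy_mean R n l = s (1 / of_nat n)
     (\<Sum>k<n. s (of_real l * cis (2 * pi * (real k / real n))) (R (of_real l * cis (2 * pi * (real k / real n)))))"

section \<open>Riemann sums for the Cauchy integral of the resolvent\<close>

context
  fixes x :: 'u and R :: "complex \<Rightarrow> 'u"
  assumes x_in: "x \<in> C" and R_in: "q \<in> polar_rats \<Longrightarrow> R q \<in> C"
    and R_left: "q \<in> polar_rats \<Longrightarrow> R q * (s q e - x) = e"
    and R_right: "q \<in> polar_rats \<Longrightarrow> (s q e - x) * R q = e"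
begin

lemma cauchy_mean_in: "l \<in> \<rat> \<Longrightarrow> cauchy_mean R n l \<in> C"
  unfolding cauchy_mean_def
  by (intro scale_in sum_in R_in polar_ratsI) (use of_real_polar_rats[of "1 / real n"] in auto)

text \<open>All nodes satisfy \<open>\<mu> k ^ n = l ^ n\<close>, so one factor serves the whole
  sum, and averaging the geometric sums over the roots of unity leaves only the term of
  \<open>e\<close>. The mean thus behaves as an inverse of \<open>e - (x / l)^n\<close>.\<close>

lemma cauchy_mean_eq:
  assumes "l \<in> \<rat>" "l > 0" "n > 0"
  shows "(e - s (of_real (1 / l ^ n)) (pw x n)) * cauchy_mean R n l = e"
proof -
  define \<mu> where "\<mu> k = complex_of_real l * cis (2 * pi * (real k / real n))" for k
  have \<mu>: "\<mu> k \<in> polar_rats" for k unfolding \<mu>_def using assms by (intro polar_ratsI) auto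
  have \<mu>n: "\<mu> k ^ n = of_real l ^ n" for k
  proof -
    have "cis (2 * pi * (real k / real n)) ^ n = 1"
    proof -
      have "real n * (2 * pi * (real k / real n)) = 2 * pi * real k" using assms by simp
      then show ?thesis by (simp only: Complex.DeMoivre) (simp add: cis_multiple_2pi)
    qed
    then show ?thesis by (simp add: \<mu>_def power_mult_distrib)
  qed
  have "(s (of_real l ^ n) e - pw x n) * (\<Sum>k<n. s (\<mu> k) (R (\<mu> k)))
      = (\<Sum>k<n. s (\<mu> k) ((s (\<mu> k ^ n) e - pw x n) * R (\<mu> k)))"
    by (simp add: sum_distrib_left s_mult_right \<mu>n)
  also have "\<dots> = (\<Sum>k<n. \<Sum>j<n. s (\<mu> k ^ (n - j)) (pw x j))"
    by (intro sum.cong refl resolvent_geometric R_right \<mu>)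
  also have "\<dots> = (\<Sum>j<n. s (\<Sum>k<n. \<mu> k ^ (n - j)) (pw x j))"
    by (subst sum.swap) (simp add: scale_sum_left)
  \<comment> \<open>The exponent \<open>n - j\<close> runs through 1 to \<open>n\<close>, so the sum
    over the nodes survives only for \<open>j = 0\<close>.\<close>
  also have "\<dots> = (\<Sum>j<n. if j = 0 then s (of_nat n * of_real l ^ n) e else 0)"
  proof (rule sum.cong, rule refl)
    fix j assume j: "j \<in> {..<n}"
    have "(\<Sum>k<n. \<mu> k ^ (n - j)) = of_real l ^ (n - j) * (\<Sum>k<n. cis (2 * pi * (real k / real n)) ^ (n - j))"
      by (simp add: \<mu>_def power_mult_distrib sum_distrib_left)
    also have "\<dots> = (if j = 0 then of_nat n * of_real l ^ n else 0)"
      using j by (subst sum_powers_unity_roots) auto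
    finally show "s (\<Sum>k<n. \<mu> k ^ (n - j)) (pw x j) = (if j = 0 then s (of_nat n * of_real l ^ n) e else 0)"
      by simp
  qed
  also have "\<dots> = s (of_nat n * of_real l ^ n) e" using assms by (simp add: sum.delta)
  finally have "(s (of_real l ^ n) e - pw x n) * cauchy_mean R n l = s (of_real l ^ n) e"
    using assms by (simp add: cauchy_mean_def s_mult_right \<mu>_def)
  then have "s (of_real (1 / l ^ n)) ((s (of_real l ^ n) e - pw x n) * cauchy_mean R n l) = e"
    using assms by simp
  then have "s (of_real (1 / l ^ n)) (s (of_real l ^ n) e - pw x n) * cauchy_mean R n l = e"
    by (simp only: s_mult_left)
  moreover have "s (of_real (1 / l ^ n)) (s (of_real l ^ n) e - pw x n) = e - s (of_real (1 / l ^ n)) (pw x n)"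
    using assms by (simp add: scale_right_diff_distrib)
  ultimately show ?thesis by simp
qed

lemma resolvent_identity:
  assumes "q \<in> polar_rats" "q' \<in> polar_rats"
  shows "R q - R q' = s (q' - q) (R q * R q')"
proof -
  have "s (q' - q) (R q * R q') = R q * ((s q' e - x) - (s q e - x)) * R q'"
    by (simp add: algebra_simps s_mult_left s_mult_right unit_left unit_right)
  also have "\<dots> = R q * ((s q' e - x) * R q') - (R q * (s q e - x)) * R q'"
    by (simp add: algebra_simps)
  finally show ?thesis using assms R_left R_right by (simp add: unit_left unit_right)
qed

section \<open>Consequences of a resolvent bound on a disc, up to a contradiction\<close>

context
  fixes B \<rho> :: real
  assumes B: "q \<in> polar_rats \<Longrightarrow> cmod q \<le> \<rho> \<Longrightarrow> p (R q) \<le> B" and \<rho>: "0 \<le> \<rho>"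
begin

lemma B_nonneg: "0 \<le> B"
  using B[of 0] R_in[of 0] p_nonneg[of "R 0"] \<rho> of_real_polar_rats[of 0] by auto

text \<open>The weights of the nodes have modulus \<open>l\<close>. Hence the means become small
  with the radius, which in the end is incompatible with their being close to
  \<open>e\<close>.\<close>

lemma p_cauchy_mean:
  assumes "l \<in> \<rat>" "0 \<le> l" "l \<le> \<rho>" "n > 0"
  shows "p (cauchy_mean R n l) \<le> l * B"
proof -
  define \<mu> where "\<mu> k = complex_of_real l * cis (2 * pi * (real k / real n))" for k
  have \<mu>: "\<mu> k \<in> polar_rats" for k unfolding \<mu>_def using assms by (intro polar_ratsI) auto
  have n\<mu>: "cmod (\<mu> k) = l" for k using assms by (simp add: \<mu>_def norm_mult)
  have "p (\<Sum>k<n. s (\<mu> k) (R (\<mu> k))) \<le> (\<Sum>k<n. p (s (\<mu> k) (R (\<mu> k))))"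
    by (intro p_sum scale_in R_in \<mu>)
  also have "\<dots> \<le> (\<Sum>k<n. l * B)"
    using \<mu> n\<mu> assms B R_in by (intro sum_mono) (auto simp: p_scale intro!: mult_left_mono)
  finally have "p (\<Sum>k<n. s (\<mu> k) (R (\<mu> k))) \<le> real n * (l * B)" by simp
  moreover have "p (cauchy_mean R n l) = 1 / real n * p (\<Sum>k<n. s (\<mu> k) (R (\<mu> k)))"
    unfolding cauchy_mean_def \<mu>_def[symmetric]
    using of_real_polar_rats[of "1 / real n"] \<mu>
    by (subst p_scale) (auto intro!: sum_in scale_in R_in simp: norm_divide)
  ultimately show ?thesis using assms by (simp add: pos_divide_le_eq mult.commute)
qed

text \<open>By the resolvent identity, \<open>\<mu> R(\<mu>)\<close> is Lipschitz along every ray,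
  with a constant that depends only on \<open>B\<close> and \<open>\<rho>\<close>. Averaging over
  the rays keeps the constant, so it is independent of \<open>n\<close>.\<close>

lemma p_cauchy_mean_diff:
  assumes "l \<in> \<rat>" "0 \<le> l" "l \<le> \<rho>" "l' \<in> \<rat>" "0 \<le> l'" "l' \<le> \<rho>" "n > 0"
  shows "p (cauchy_mean R n l - cauchy_mean R n l') \<le> \<bar>l - l'\<bar> * (B + \<rho> * B\<^sup>2)"
proof -
  define \<omega> where "\<omega> k = cis (2 * pi * (real k / real n))" for k
  have \<mu>: "of_real r * \<omega> k \<in> polar_rats" if "r \<in> \<rat>" for k r
    unfolding \<omega>_def using that by (intro polar_ratsI) auto
  have n\<mu>: "cmod (\<omega> k) = 1" for k by (simp add: \<omega>_def)
  \<comment> \<open>The cofactor of \<open>(l - l') \<omega>\<close> in the difference of the two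
    summands on the ray of \<open>\<omega>\<close>; see \<open>summand\<close>.\<close>
  define T where "T k = R (of_real l * \<omega> k)
    - s (of_real l' * \<omega> k) (R (of_real l * \<omega> k) * R (of_real l' * \<omega> k))" for k
  have T_in: "T k \<in> C" for k
    unfolding T_def using assms by (intro diff_in scale_in mult_in R_in \<mu>)
  have pT: "p (T k) \<le> B + \<rho> * B\<^sup>2" for k
  proof -
    let ?a = "R (of_real l * \<omega> k)" and ?b = "R (of_real l' * \<omega> k)"
    have ab: "?a \<in> C" "?b \<in> C" using assms by (auto intro!: R_in \<mu>)
    have pab: "p ?a \<le> B" "p ?b \<le> B" using assms \<mu> n\<mu> by (auto intro!: B simp: norm_mult)
    have "p (T k) \<le> p ?a + l' * p (?a * ?b)"
      unfolding T_def using p_diff[of ?a "s (of_real l' * \<omega> k) (?a * ?b)"] ab assms \<mu> n\<mu>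
      by (auto simp: p_scale scale_in mult_in norm_mult)
    also have "p (?a * ?b) \<le> B * B"
      using p_mult[OF ab] mult_mono[OF pab] B_nonneg p_nonneg[OF ab(2)] by linarith
    then have "p ?a + l' * p (?a * ?b) \<le> B + \<rho> * (B * B)"
      using pab assms p_nonneg[OF mult_in[OF ab]] by (intro add_mono mult_mono) auto
    finally show ?thesis by (simp add: power2_eq_square)
  qed
  have summand: "s (of_real l * \<omega> k) (R (of_real l * \<omega> k)) - s (of_real l' * \<omega> k) (R (of_real l' * \<omega> k))
      = s (of_real (l - l') * \<omega> k) (T k)" for k
  proof -
    let ?m = "of_real l * \<omega> k" and ?m' = "of_real l' * \<omega> k"
    have "R ?m' = R ?m - s (?m' - ?m) (R ?m * R ?m')"
      using resolvent_identity[OF \<mu> \<mu>, of l l' k k] assms by (simp add: algebra_simps)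
    then have "s ?m (R ?m) - s ?m' (R ?m')
      = s ?m (R ?m) - s ?m' (R ?m) + s ?m' (s (?m' - ?m) (R ?m * R ?m'))"
      by (metis (no_types, lifting) scale_right_diff_distrib diff_diff_eq2 diff_add_eq)
    also have "\<dots> = s (?m - ?m') (R ?m) - s (?m - ?m') (s ?m' (R ?m * R ?m'))"
      by (simp add: scale_left_diff_distrib scale_scale algebra_simps)
    finally show ?thesis
      by (simp add: T_def scale_right_diff_distrib algebra_simps)
  qed
  have "cauchy_mean R n l - cauchy_mean R n l' = s (1 / of_nat n) (\<Sum>k<n. s (of_real (l - l') * \<omega> k) (T k))"
    unfolding cauchy_mean_def \<omega>_def[symmetric]
    by (simp only: scale_right_diff_distrib[symmetric] sum_subtractf[symmetric] summand)
  moreover have "(\<Sum>k<n. s (of_real (l - l') * \<omega> k) (T k)) \<in> C"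
    using assms by (intro sum_in scale_in \<mu> T_in) auto
  ultimately have "p (cauchy_mean R n l - cauchy_mean R n l')
      = 1 / real n * p (\<Sum>k<n. s (of_real (l - l') * \<omega> k) (T k))"
    using of_real_polar_rats[of "1 / real n"] p_scale[of "1 / of_nat n"] by (simp add: norm_divide)
  moreover have "p (\<Sum>k<n. s (of_real (l - l') * \<omega> k) (T k)) \<le> (\<Sum>k<n. p (s (of_real (l - l') * \<omega> k) (T k)))"
    using assms by (intro p_sum scale_in \<mu> T_in) auto
  moreover have "\<dots> \<le> (\<Sum>k<n. \<bar>l - l'\<bar> * (B + \<rho> * B\<^sup>2))"
  proof (rule sum_mono)
    fix k
    have "p (s (of_real (l - l') * \<omega> k) (T k)) = \<bar>l - l'\<bar> * p (T k)"
      using \<mu>[of "l - l'" k] assms T_in n\<mu>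
      by (subst p_scale) (auto simp: norm_mult simp flip: of_real_diff)
    then show "p (s (of_real (l - l') * \<omega> k) (T k)) \<le> \<bar>l - l'\<bar> * (B + \<rho> * B\<^sup>2)"
      using pT by (simp add: mult_left_mono)
  qed
  ultimately have "p (cauchy_mean R n l - cauchy_mean R n l')
     \<le> 1 / real n * (real n * (\<bar>l - l'\<bar> * (B + \<rho> * B\<^sup>2)))"
    by (simp add: mult_left_mono del: times_divide_eq_left times_divide_eq_right)
  then show ?thesis using assms by simp
qed

text \<open>By \<open>cauchy_mean_eq\<close>, the Cauchy mean of radius \<open>l\<close> is close to \<open>e\<close> iff the powers of \<open>x / l\<close>
  are under control, and it is Lipschitz in \<open>l\<close> uniformly in \<open>n\<close>.  So the bound on powers
  passes to slightly smaller radii, by a step that does not depend on \<open>l\<close>.\<close>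

lemma power_bound_transfer:
  assumes bd: "\<forall>\<^sub>F n in sequentially. p (pw x n) \<le> 3 * l ^ n"
    and l: "0 < l" "l < l1" and l1: "l1 \<in> \<rat>" "l1 \<le> \<rho>" and l': "l' \<in> \<rat>" "0 < l'" "l' \<le> l1"
    and near: "(l1 - l') * (B + \<rho> * B\<^sup>2) \<le> 1 / 6"
  shows "\<forall>\<^sub>F n in sequentially. p (cauchy_mean R n l' - e) \<le> 1 / 2 \<and> p (pw x n) \<le> 3 * l' ^ n"
proof -
  \<comment> \<open>The hypothesis at radius \<open>l\<close> only bounds \<open>(x / l)^n\<close>
    by 3. Passing to the strictly larger \<open>l1\<close> makes the normalized powers tend to
    0.\<close>
  have "(\<lambda>n. 3 * (l / l1) ^ n) \<longlonglongrightarrow> 3 * 0"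
    using l by (intro tendsto_mult tendsto_const LIMSEQ_realpow_zero) auto
  then have "\<forall>\<^sub>F n in sequentially. 3 * (l / l1) ^ n < 1 / 4"
    by (rule order_tendstoD) auto
  with bd eventually_gt_at_top[of 0] show ?thesis
  proof eventually_elim
    case (elim n)
    define F where "F = cauchy_mean R n l1"
    define F' where "F' = cauchy_mean R n l'"
    define z where "z = s (of_real (1 / l1 ^ n)) (pw x n)"
    define z' where "z' = s (of_real (1 / l' ^ n)) (pw x n)"
    have inC: "F \<in> C" "F' \<in> C" "z \<in> C" "z' \<in> C"
      unfolding F_def F'_def z_def z'_def using l1 l'
      by (auto intro!: cauchy_mean_in scale_in pw_in x_in of_real_polar_rats simp del: of_real_divide of_real_power)
    have pz: "p z \<le> 1 / 4"
    proof -
      have "p z = p (pw x n) / l1 ^ n"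
        unfolding z_def using l l1 pw_in[OF x_in]
        by (subst p_scale) (auto intro!: of_real_polar_rats simp: norm_divide norm_power simp del: of_real_divide of_real_power)
      also have "\<dots> \<le> 3 * l ^ n / l1 ^ n" using elim l by (intro divide_right_mono) auto
      also have "\<dots> \<le> 1 / 4" using elim by (simp add: power_divide)
      finally show ?thesis .
    qed
    have "(e - z) * F = e"
      unfolding z_def F_def using l l1 elim by (intro cauchy_mean_eq) auto
    \<comment> \<open>With \<open>p z \<le> 1/4\<close> this gives
      \<open>p (F - e) \<le> 1/4 * (1 + p (F - e))\<close>, hence the bound 1/3.\<close>
    then have "F - e = z * F" by (simp add: left_diff_distrib unit_left algebra_simps)
    moreover have "p F \<le> 1 + p (F - e)"
      using p_add[of e "F - e"] inC diff_in unit_in p_unit by simp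
    moreover have "p (z * F) \<le> 1 / 4 * p F"
      using p_mult[of z F] pz inC p_nonneg by (meson mult_right_mono order_trans)
    ultimately have Fe: "p (F - e) \<le> 1 / 3" by simp
    have "p (F - F') \<le> 1 / 6"
      using p_cauchy_mean_diff[of l1 l' n] l l1 l' near elim by (simp add: F_def F'_def)
    moreover have "p (F' - e) \<le> p (F - e) + p (F - F')"
      using p_diff[of "F - e" "F - F'"] inC diff_in unit_in by simp
    ultimately have F'e: "p (F' - e) \<le> 1 / 2" using Fe by linarith
    have "(e - z') * F' = e"
      unfolding z'_def F'_def using l' elim by (intro cauchy_mean_eq) auto
    \<comment> \<open>The same absorption in the other direction: the error term has size at most
      half of \<open>p (e - z')\<close>, so \<open>p (e - z') \<le> 2\<close> and
      \<open>p z' \<le> 3\<close>. This reproduces the constant 3 of the hypothesis, so the lemma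
      can be iterated.\<close>
    then have "e - z' = e - (e - z') * (F' - e)"
      by (simp add: algebra_simps unit_left unit_right)
    then have "p (e - z') \<le> 1 + p ((e - z') * (F' - e))"
      using p_diff[of e "(e - z') * (F' - e)"] inC diff_in unit_in mult_in p_unit by metis
    also have "p ((e - z') * (F' - e)) \<le> p (e - z') * (1 / 2)"
      using p_mult[of "e - z'" "F' - e"] F'e inC diff_in unit_in p_nonneg
      by (meson mult_left_mono order_trans)
    finally have "p (e - z') \<le> 2" by simp
    then have "p z' \<le> 3"
      using p_diff[of e "e - z'"] inC diff_in unit_in p_unit by simp
    moreover have "p z' = p (pw x n) / l' ^ n"
      unfolding z'_def using l' pw_in[OF x_in]
      by (subst p_scale) (auto intro!: of_real_polar_rats simp: norm_divide norm_power simp del: of_real_divide of_real_power)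
    ultimately show ?case using F'e l' by (simp add: F'_def pos_divide_le_eq)
  qed
qed

text \<open>Start at a radius above \<open>p x\<close>, where the powers are controlled trivially,
  and descend by steps of fixed size to a radius as small as desired. There the mean lies within 1/2
  of \<open>e\<close> for large \<open>n\<close>, while its own seminorm is below 1/2.\<close>

lemma no_bounded_resolvent:
  assumes px: "p x < \<rho>"
  shows False
proof -
  define L where "L = B + \<rho> * B\<^sup>2"
  have L: "L \<ge> 0" using B_nonneg \<rho> by (simp add: L_def)
  obtain l0 where l0: "l0 \<in> \<rat>" "p x < l0" "l0 < \<rho>" using Rats_dense_in_real[OF px] by blast
  have l0_pos: "0 < l0" using l0 p_nonneg[OF x_in] by linarith
  \<comment> \<open>The first bound keeps the auxiliary radius, at most \<open>l0 + d\<close>,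
    inside the disc; the second makes a Lipschitz loss over length \<open>2 * d\<close> at most
    1/6.\<close>
  have "0 < min (\<rho> - l0) (1 / (12 * (L + 1)))" using l0 L by simp
  then obtain d where d: "d \<in> \<rat>" "0 < d" "d < min (\<rho> - l0) (1 / (12 * (L + 1)))"
    using Rats_dense_in_real by blast
  have dL: "2 * d * L \<le> 1 / 6"
  proof -
    have "d * (12 * (L + 1)) < 1" using d L by (simp add: pos_less_divide_eq)
    then show ?thesis using d by (simp add: algebra_simps)
  qed
  have start: "\<forall>\<^sub>F n in sequentially. p (pw x n) \<le> 3 * l0 ^ n"
  proof (rule always_eventually, rule allI)
    fix n
    have "p (pw x n) \<le> p x ^ n" by (rule p_pw[OF x_in])
    also have "\<dots> \<le> l0 ^ n" using l0 p_nonneg[OF x_in] by (intro power_mono) auto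
    also have "\<dots> \<le> 3 * l0 ^ n" using l0_pos by simp
    finally show "p (pw x n) \<le> 3 * l0 ^ n" .
  qed
  have descent: "\<forall>\<^sub>F n in sequentially. p (cauchy_mean R n l' - e) \<le> 1 / 2 \<and> p (pw x n) \<le> 3 * l' ^ n"
    if "l' \<in> \<rat>" "0 < l'" "l' \<le> l0" "l0 - real k * d \<le> l'" for k l'
    using that
  proof (induction k arbitrary: l')
    case 0
    then have "l' = l0" by simp
    then show ?case
      using power_bound_transfer[OF start, of "l0 + d" l'] l0 l0_pos d L dL
      by (auto simp: L_def[symmetric])
  next
    case (Suc k)
    \<comment> \<open>One step back up, cut off at \<open>l0\<close> because the induction
      hypothesis covers only radii up to there. With auxiliary radius \<open>l + d\<close> the total
      distance to \<open>l'\<close> is at most \<open>2 * d\<close>.\<close>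
    define l where "l = min l0 (l' + d)"
    have "\<forall>\<^sub>F n in sequentially. p (cauchy_mean R n l - e) \<le> 1 / 2 \<and> p (pw x n) \<le> 3 * l ^ n"
      using Suc.prems d l0 l0_pos by (intro Suc.IH) (auto simp: l_def min_def algebra_simps)
    then have "\<forall>\<^sub>F n in sequentially. p (pw x n) \<le> 3 * l ^ n" by eventually_elim simp
    moreover have "(l + d - l') * L \<le> 2 * d * L" using L by (intro mult_right_mono) (auto simp: l_def)
    moreover have "l0 + d \<le> \<rho>" using d by simp
    ultimately show ?case
      using Suc.prems d(1,2) l0 l0_pos dL
      by (intro power_bound_transfer[of l "l + d"]) (auto simp: l_def min_def L_def[symmetric])
  qed
  have "0 < min l0 (1 / (2 * (B + 1)))" using l0_pos B_nonneg by simp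
  then obtain l where l: "l \<in> \<rat>" "0 < l" "l < min l0 (1 / (2 * (B + 1)))"
    using Rats_dense_in_real by blast
  have lB: "l * B < 1 / 2"
  proof -
    have "l * (2 * (B + 1)) < 1" using l B_nonneg by (simp add: pos_less_divide_eq)
    then show ?thesis using l by (simp add: algebra_simps)
  qed
  obtain k where "l0 / d < real k" using reals_Archimedean2 by blast
  then have "l0 - real k * d \<le> l" using d l by (simp add: pos_divide_less_eq)
  then have "\<forall>\<^sub>F n in sequentially. p (cauchy_mean R n l - e) \<le> 1 / 2"
    using descent[of l k] l by (auto elim: eventually_mono)
  then have "\<forall>\<^sub>F n in sequentially. p (cauchy_mean R n l - e) \<le> 1 / 2 \<and> n > 0"
    using eventually_gt_at_top by (rule eventually_conj)
  then obtain n where n: "p (cauchy_mean R n l - e) \<le> 1 / 2" "n > 0"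
    using eventually_happens'[OF sequentially_bot] by blast
  have "1 \<le> p (cauchy_mean R n l) + p (cauchy_mean R n l - e)"
    using p_diff[of "cauchy_mean R n l" "cauchy_mean R n l - e"] cauchy_mean_in[of l n] l diff_in unit_in p_unit
    by simp
  then show False using n p_cauchy_mean[of l n] l l0 lB by auto
qed

end

lemma resolvent_unbounded:
  "\<exists>q\<in>polar_rats. cmod q \<le> p x + 1 \<and> B < p (R q)"
proof (rule ccontr)
  assume "\<not> ?thesis"
  then have "p (R q) \<le> B" if "q \<in> polar_rats" "cmod q \<le> p x + 1" for q
    using that by (meson not_le)
  then show False using no_bounded_resolvent[of "p x + 1" B] p_nonneg[OF x_in] by simp
qed

end

end

section \<open>Measurable selection of a blow-up point\<close>

text \<open>The closure is the union of countably many stages, and two arguments always lie in a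
  common stage. Unary operations fit in as binary ones that ignore an argument.\<close>

lemma countable_closure:
  fixes G :: "'a set" and F :: "('a \<Rightarrow> 'a \<Rightarrow> 'a) set"
  assumes "countable G" "countable F"
  obtains C where "countable C" "G \<subseteq> C" "\<And>f u v. f \<in> F \<Longrightarrow> u \<in> C \<Longrightarrow> v \<in> C \<Longrightarrow> f u v \<in> C"
proof
  define step where "step K = K \<union> (\<Union>f\<in>F. (\<lambda>(u, v). f u v) ` (K \<times> K))" for K
  define K where "K n = (step ^^ n) G" for n
  have K_Suc: "K (Suc n) = step (K n)" for n by (simp add: K_def)
  have mono: "K m \<subseteq> K n" if "m \<le> n" for m n
    using that by (rule lift_Suc_mono_le[rotated]) (auto simp: K_Suc step_def)
  have "countable (K n)" for n
    by (induction n) (use assms in \<open>auto simp: K_def step_def intro!: countable_UN countable_image countable_SIGMA\<close>)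
  then show "countable (\<Union>n. K n)" by simp
  show "G \<subseteq> (\<Union>n. K n)" by (auto simp: K_def intro!: exI[of _ 0])
  fix f u v assume f: "f \<in> F" and uv: "u \<in> (\<Union>n. K n)" "v \<in> (\<Union>n. K n)"
  then obtain m n where "u \<in> K m" "v \<in> K n" by auto
  then have "u \<in> K (max m n)" "v \<in> K (max m n)" using mono by (meson max.cobounded1 max.cobounded2 subsetD)+
  then have "f u v \<in> K (Suc (max m n))" using f by (auto simp: K_Suc step_def)
  then show "f u v \<in> (\<Union>n. K n)" by blast
qed

text \<open>Some subsequence converges to the lower limit. Boundedness makes this limit finite, so
  \<open>real_of_ereal\<close> returns it and not the default value 0.\<close>

lemma liminf_cluster_point:
  fixes u :: "nat \<Rightarrow> real"
  assumes bd: "\<And>n. \<bar>u n\<bar> \<le> b" and "\<epsilon> > 0"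
  shows "\<exists>n\<ge>m. \<bar>u n - real_of_ereal (liminf (\<lambda>n. ereal (u n)))\<bar> < \<epsilon>"
proof -
  define l where "l = liminf (\<lambda>n. ereal (u n))"
  obtain r where r: "strict_mono r" "((\<lambda>n. ereal (u n)) \<circ> r) \<longlonglongrightarrow> l"
    unfolding l_def using liminf_subseq_lim by blast
  have bd': "- b \<le> u n" "u n \<le> b" for n using bd[of n] by auto
  have "l \<le> ereal b" by (rule LIMSEQ_le_const2[OF r(2)]) (use bd' in auto)
  moreover have "ereal (- b) \<le> l" by (rule LIMSEQ_le_const[OF r(2)]) (use bd'(1) in auto)
  ultimately obtain L where L: "l = ereal L" by (cases l) auto
  with r have "(\<lambda>n. u (r n)) \<longlonglongrightarrow> L" by (simp add: o_def)
  then have "\<forall>\<^sub>F n in sequentially. dist (u (r n)) L < \<epsilon>" using assms by (simp add: tendsto_iff)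
  then obtain N where N: "\<And>n. n \<ge> N \<Longrightarrow> dist (u (r n)) L < \<epsilon>" by (auto simp: eventually_sequentially)
  have "r (max m N) \<ge> m" using seq_suble[OF r(1), of "max m N"] by simp
  then show ?thesis using N[of "max m N"] L l_def by (intro exI[of _ "r (max m N)"]) (auto simp: dist_real_def)
qed

text \<open>Lower limits of measurable functions are measurable. The real part is the lower limit of
  the real parts; the imaginary part is the lower limit along indices chosen so that the real parts
  converge. The cluster property is claimed only at points where the sequence is bounded.\<close>

lemma measurable_cluster_point:
  fixes u :: "nat \<Rightarrow> 'w \<Rightarrow> complex"
  assumes u [measurable]: "\<And>n. u n \<in> borel_measurable M"
  obtains a where "a \<in> borel_measurable M"
    and "\<And>w b m \<epsilon>. (\<And>n. cmod (u n w) \<le> b) \<Longrightarrow> \<epsilon> > 0 \<Longrightarrow> \<exists>n\<ge>m. cmod (u n w - a w) < \<epsilon>"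
proof
  define \<alpha> where "\<alpha> w = real_of_ereal (liminf (\<lambda>n. ereal (Re (u n w))))" for w
  have [measurable]: "\<alpha> \<in> borel_measurable M" unfolding \<alpha>_def by measurable
  \<comment> \<open>Taking the least index makes the choice measurable, and \<open>k \<le> n\<close>
    forces the chosen indices to infinity.\<close>
  define t where "t k w = (LEAST n. k \<le> n \<and> \<bar>Re (u n w) - \<alpha> w\<bar> < 1 / real (Suc k))" for k w
  have [measurable]: "t k \<in> measurable M (count_space UNIV)" for k unfolding t_def by measurable
  define v where "v k w = u (t k w) w" for k w
  have [measurable]: "v k \<in> borel_measurable M" for k
    unfolding v_def by (rule measurable_compose_countable) measurable
  define \<beta> where "\<beta> w = real_of_ereal (liminf (\<lambda>k. ereal (Im (v k w))))" for w
  have [measurable]: "\<beta> \<in> borel_measurable M" unfolding \<beta>_def by measurable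
  show "(\<lambda>w. Complex (\<alpha> w) (\<beta> w)) \<in> borel_measurable M"
    unfolding Complex_eq by measurable
  fix w b m and \<epsilon> :: real
  assume bd: "\<And>n. cmod (u n w) \<le> b" and \<epsilon>: "\<epsilon> > 0"
  have t: "k \<le> t k w \<and> \<bar>Re (u (t k w) w) - \<alpha> w\<bar> < 1 / real (Suc k)" for k
    unfolding t_def \<alpha>_def
    by (rule LeastI_ex, rule liminf_cluster_point[where b = b])
       (use bd abs_Re_le_cmod order_trans in \<open>blast\<close>, simp)
  obtain N where N: "1 / real (Suc N) < \<epsilon> / 2" using \<epsilon> nat_approx_posE[of "\<epsilon> / 2"] by auto
  have "\<exists>k\<ge>max m N. \<bar>Im (v k w) - \<beta> w\<bar> < \<epsilon> / 2"
    unfolding \<beta>_def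
    by (rule liminf_cluster_point[where b = b])
       (use bd abs_Im_le_cmod order_trans v_def \<epsilon> in \<open>metis\<close>, use \<epsilon> in simp)
  then obtain k where k: "k \<ge> max m N" "\<bar>Im (v k w) - \<beta> w\<bar> < \<epsilon> / 2" by blast
  have "1 / real (Suc k) \<le> 1 / real (Suc N)" using k by (simp add: frac_le)
  then have "\<bar>Re (u (t k w) w) - \<alpha> w\<bar> < \<epsilon> / 2" using t[of k] N by linarith
  then have "cmod (u (t k w) w - Complex (\<alpha> w) (\<beta> w)) < \<epsilon>"
    using k(2) cmod_le[of "u (t k w) w - Complex (\<alpha> w) (\<beta> w)"] by (simp add: v_def)
  moreover have "t k w \<ge> m" using t[of k] k by linarith
  ultimately show "\<exists>n\<ge>m. cmod (u n w - Complex (\<alpha> w) (\<beta> w)) < \<epsilon>" by blast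
qed

text \<open>For each \<open>n\<close>, the first member of an enumeration of \<open>Q\<close> at
  which \<open>f\<close> exceeds \<open>n\<close> depends measurably on \<open>w\<close>. These
  members stay in a disc, and near a cluster point of them \<open>f\<close> is unbounded.\<close>

lemma measurable_blow_up_point:
  fixes f :: "complex \<Rightarrow> 'w \<Rightarrow> real"
  assumes Q: "countable Q" "Q \<noteq> {}"
    and f: "\<And>q. q \<in> Q \<Longrightarrow> f q \<in> borel_measurable M" and g [measurable]: "g \<in> borel_measurable M"
    and ub: "AE w in M. \<forall>B. \<exists>q\<in>Q. cmod q \<le> g w \<and> B < f q w"
  obtains a where "a \<in> borel_measurable M"
    and "AE w in M. \<forall>\<epsilon>>0. \<forall>B. \<exists>q\<in>Q. cmod q \<le> g w \<and> cmod (q - a w) < \<epsilon> \<and> B < f q w"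
proof -
  define d where "d = from_nat_into Q"
  have d: "d i \<in> Q" for i unfolding d_def using Q by (simp add: from_nat_into)
  have d_surj: "\<exists>i. d i = q" if "q \<in> Q" for q
    unfolding d_def using from_nat_into_surj Q that by metis
  have [measurable]: "f (d i) \<in> borel_measurable M" for i using f d by blast
  define j where "j n w = (LEAST i. cmod (d i) \<le> g w \<and> real n < f (d i) w)" for n w
  have [measurable]: "j n \<in> measurable M (count_space UNIV)" for n unfolding j_def by measurable
  have "(\<lambda>w. d (j n w)) \<in> borel_measurable M" for n by measurable
  then obtain a where a: "a \<in> borel_measurable M"
    "\<And>w b m \<epsilon>. (\<And>n. cmod (d (j n w)) \<le> b) \<Longrightarrow> \<epsilon> > 0 \<Longrightarrow> \<exists>n\<ge>m. cmod (d (j n w) - a w) < \<epsilon>"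
    using measurable_cluster_point[of "\<lambda>n w. d (j n w)" M] by metis
  have "AE w in M. \<forall>\<epsilon>>0. \<forall>B. \<exists>q\<in>Q. cmod q \<le> g w \<and> cmod (q - a w) < \<epsilon> \<and> B < f q w"
    using ub
  proof eventually_elim
    case (elim w)
    have j: "cmod (d (j n w)) \<le> g w \<and> real n < f (d (j n w)) w" for n
      unfolding j_def by (rule LeastI_ex) (use elim d_surj in metis)
    show ?case
    proof (intro allI impI)
      fix \<epsilon> B :: real assume "\<epsilon> > 0"
      obtain m where "B < real m" using reals_Archimedean2 by blast
      moreover obtain n where "n \<ge> m" "cmod (d (j n w) - a w) < \<epsilon>"
        using a(2)[of w "g w" \<epsilon> m] j \<open>\<epsilon> > 0\<close> by blast
      ultimately show "\<exists>q\<in>Q. cmod q \<le> g w \<and> cmod (q - a w) < \<epsilon> \<and> B < f q w"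
        using j[of n] d by (intro bexI[of _ "d (j n w)"]) auto
    qed
  qed
  then show thesis using a(1) that by blast
qed

section \<open>Pointwise norms\<close>

lemma rep_L0:
  assumes "a \<in> L0 M"
  shows "rep a \<in> borel_measurable M" "L0_class M (rep a) = a"
proof -
  obtain f where f: "f \<in> borel_measurable M" "a = L0_class M f" by (rule L0_cases[OF assms])
  then show "rep a \<in> borel_measurable M" using rep_L0_class(1) by simp
  then show "L0_class M (rep a) = a" using f rep_L0_class(2)[OF f(1)] by (simp add: L0_class_eq_iff)
qed

locale unital_algebra_over_solid = faithful_solid_subalgebra M E +
    unital_banach_kantorovich_algebra scaleC M E nrm act e
  for scaleC :: "complex \<Rightarrow> 'u::ring \<Rightarrow> 'u" and M :: "'w measure"
    and E :: "('w \<Rightarrow> complex) set set" and nrm :: "'u \<Rightarrow> ('w \<Rightarrow> complex) set"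
    and act :: "('w \<Rightarrow> complex) set \<Rightarrow> 'u \<Rightarrow> 'u" and e :: 'u
begin

text \<open>By \<open>rep_nrm\<close> the chosen representative is almost everywhere a nonnegative
  real, so \<open>Re\<close> only changes the type.\<close>

definition pnorm :: "'u \<Rightarrow> 'w \<Rightarrow> real" where
  "pnorm u w = Re (rep (nrm u) w)"

text \<open>Complex scalars act through the constants of \<open>E\<close>, since \<open>scaleC\<close> need not agree with \<open>act\<close>.\<close>

definition smult :: "complex \<Rightarrow> 'u \<Rightarrow> 'u" where
  "smult c = act (L0_const M c)"

section \<open>Norm and module laws read off representatives almost everywhere\<close>

lemma E_L0: "a \<in> E \<Longrightarrow> a \<in> L0 M"
  using sub_L0 by blast

lemma E_rep_measurable: "a \<in> E \<Longrightarrow> rep a \<in> borel_measurable M"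
  using rep_L0 E_L0 by blast

lemma rep_nrm_measurable [measurable]: "rep (nrm u) \<in> borel_measurable M"
  using E_rep_measurable nrm_in by blast

lemma pnorm_measurable [measurable]: "pnorm u \<in> borel_measurable M"
  unfolding pnorm_def by measurable

lemma const_in_E: "L0_const M c \<in> E"
  using Linfty_sub L0_ops_class(8)[of "\<lambda>_. c" M "\<lambda>_. c"] by (auto simp: L0_const_def)

lemma rep_const: "AE w in M. rep (L0_const M c) w = c"
  unfolding L0_const_def by (rule rep_L0_class) simp

lemma rep_add: "a \<in> E \<Longrightarrow> b \<in> E \<Longrightarrow> AE w in M. rep (L0_add M a b) w = rep a w + rep b w"
  unfolding L0_add_def by (rule rep_L0_class) (intro borel_measurable_add E_rep_measurable)

lemma rep_mult: "a \<in> E \<Longrightarrow> b \<in> E \<Longrightarrow> AE w in M. rep (L0_mult M a b) w = rep a w * rep b w"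
  unfolding L0_mult_def by (rule rep_L0_class) (intro borel_measurable_times E_rep_measurable)

lemma rep_abs: "a \<in> E \<Longrightarrow> AE w in M. rep (L0_abs M a) w = of_real (cmod (rep a w))"
  unfolding L0_abs_def using E_rep_measurable[of a] by (intro rep_L0_class) measurable

lemma abs_in_E:
  assumes "a \<in> E"
  shows "L0_abs M a \<in> E"
proof (rule solid[OF _ assms])
  have [measurable]: "rep a \<in> borel_measurable M" using E_rep_measurable assms .
  show "L0_abs M a \<in> L0 M" unfolding L0_abs_def by (rule L0_class_in_L0) measurable
  have "AE w in M. rep (L0_abs M (L0_abs M a)) w = of_real (cmod (rep (L0_abs M a) w))"
    unfolding L0_abs_def[of M "L0_abs M a"]
    by (rule rep_L0_class) (use rep_L0(1)[OF \<open>L0_abs M a \<in> L0 M\<close>] in measurable)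
  with rep_abs[OF assms] show "L0_le M (L0_abs M (L0_abs M a)) (L0_abs M a)"
    unfolding L0_le_def by eventually_elim simp
qed

lemma rep_nrm: "AE w in M. rep (nrm u) w = of_real (pnorm u w) \<and> 0 \<le> pnorm u w"
  using nrm_nonneg[of u] rep_const[of 0] unfolding L0_le_def
  by eventually_elim (auto simp: pnorm_def less_eq_complex_def complex_eq_iff)

lemma pnorm_add: "AE w in M. pnorm (u + v) w \<le> pnorm u w + pnorm v w"
  using nrm_triangle[of u v] rep_add[OF nrm_in nrm_in, of u v] unfolding L0_le_def
  by eventually_elim (auto simp: pnorm_def less_eq_complex_def)

lemma pnorm_mult: "AE w in M. pnorm (u * v) w \<le> pnorm u w * pnorm v w"
  using nrm_mult[of u v] rep_mult[OF nrm_in nrm_in, of u v] rep_nrm[of u] rep_nrm[of v]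
  unfolding L0_le_def
  by eventually_elim (simp add: pnorm_def[of "u * v"] less_eq_complex_def)

lemma pnorm_act:
  assumes "a \<in> E"
  shows "AE w in M. pnorm (act a u) w = cmod (rep a w) * pnorm u w"
  using rep_mult[OF abs_in_E[OF assms] nrm_in, of u] rep_abs[OF assms] rep_nrm[of u]
  unfolding nrm_act[OF assms, symmetric]
  by eventually_elim (simp add: pnorm_def[of "act a u"])

lemma pnorm_smult: "AE w in M. pnorm (smult c u) w = cmod c * pnorm u w"
  using pnorm_act[OF const_in_E, of c u] rep_const[of c] unfolding smult_def
  by eventually_elim simp

lemma pnorm_unit: "AE w in M. pnorm e w = 1"
  using rep_const[of 1] unfolding pnorm_def nrm_unit by eventually_elim simp

lemma const_add: "L0_const M (c + d) = L0_add M (L0_const M c) (L0_const M d)"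
  and const_mult: "L0_const M (c * d) = L0_mult M (L0_const M c) (L0_const M d)"
  unfolding L0_const_def by (simp_all add: L0_ops_class)

lemma module_smult: "module smult"
  by unfold_locales
     (simp_all add: smult_def act_add_right const_in_E const_add act_add_left const_mult act_act act_one)

text \<open>Every instance of a law fails only on a null set, and countability of \<open>C\<close>
  and \<open>polar_rats\<close> leaves countably many instances.\<close>

lemma AE_seminormed_algebra:
  assumes C: "countable C" "e \<in> C"
    and add: "\<And>u v. u \<in> C \<Longrightarrow> v \<in> C \<Longrightarrow> u + v \<in> C"
    and mult: "\<And>u v. u \<in> C \<Longrightarrow> v \<in> C \<Longrightarrow> u * v \<in> C"
    and scale: "\<And>q u. q \<in> polar_rats \<Longrightarrow> u \<in> C \<Longrightarrow> smult q u \<in> C"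
  shows "AE w in M. seminormed_algebra smult e C (\<lambda>u. pnorm u w)"
proof -
  have "AE w in M. \<forall>u\<in>C. 0 \<le> pnorm u w"
    using rep_nrm by (intro AE_ball_countable'[OF _ C(1)]) (auto elim: eventually_mono)
  moreover have "AE w in M. \<forall>u\<in>C. \<forall>v\<in>C. pnorm (u + v) w \<le> pnorm u w + pnorm v w"
    by (intro AE_ball_countable'[OF _ C(1)] pnorm_add)
  moreover have "AE w in M. \<forall>u\<in>C. \<forall>v\<in>C. pnorm (u * v) w \<le> pnorm u w * pnorm v w"
    by (intro AE_ball_countable'[OF _ C(1)] pnorm_mult)
  moreover have "AE w in M. \<forall>q\<in>polar_rats. \<forall>u\<in>C. pnorm (smult q u) w = cmod q * pnorm u w"
    by (intro AE_ball_countable'[OF _ C(1)] AE_ball_countable'[OF _ countable_polar_rats] pnorm_smult)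
  ultimately show ?thesis using pnorm_unit
  proof eventually_elim
    case (elim w)
    show ?case
      by (intro seminormed_algebra.intro seminormed_algebra_axioms.intro module_smult)
         (use elim assms in \<open>auto simp: smult_def act_mult_left act_mult_right const_in_E unit_left unit_right\<close>)
  qed
qed

text \<open>The resolvent identity with one parameter a function: expanding
  \<open>r * (a e - x) * r'\<close> in two ways gives \<open>r = b r r' + r'\<close> with
  \<open>b = a - q\<close>, and norms are then taken pointwise.\<close>

lemma resolvent_bound:
  assumes a: "a \<in> borel_measurable M" "L0_class M a \<in> E"
    and r: "r * (smult q e - x) = e" and r': "(act (L0_class M a) e - x) * r' = e"
  shows "AE w in M. pnorm r w \<le> pnorm r' w + cmod (q - a w) * (pnorm r w * pnorm r' w)"
proof -
  have [measurable]: "a \<in> borel_measurable M" by fact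
  define b where "b = L0_class M (\<lambda>w. a w - q)"
  have "b = L0_add M (L0_class M a) (L0_const M (- q))"
    unfolding b_def L0_const_def by (simp add: L0_ops_class)
  then have b: "b \<in> E" using add_closed a const_in_E by simp
  have "L0_class M a = L0_add M b (L0_const M q)"
    unfolding b_def L0_const_def by (simp add: L0_ops_class)
  then have "act (L0_class M a) e - x = act b e + (smult q e - x)"
    using b const_in_E by (simp add: act_add_left smult_def)
  then have "r * (act (L0_class M a) e - x) * r' = r * act b e * r' + (r * (smult q e - x)) * r'"
    by (simp only: distrib_left distrib_right)
  moreover have "r * (act (L0_class M a) e - x) * r' = r"
    using r' by (simp add: mult.assoc unit_right)
  ultimately have eq: "r = act b (r * r') + r'"
    using b r by (simp add: act_mult_left act_mult_right unit_left unit_right)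
  have "AE w in M. pnorm r w \<le> pnorm (act b (r * r')) w + pnorm r' w"
    using pnorm_add[of "act b (r * r')" r'] eq by simp
  moreover have "AE w in M. rep b w = a w - q" unfolding b_def by (rule rep_L0_class) measurable
  ultimately show ?thesis using pnorm_act[OF b, of "r * r'"] pnorm_mult[of r r']
  proof eventually_elim
    case (elim w)
    then show ?case
      using mult_left_mono[of "pnorm (r * r') w" "pnorm r w * pnorm r' w" "cmod (q - a w)"]
      by (simp add: norm_minus_commute)
  qed
qed

text \<open>\<open>nrm x\<close> and the constant 1 lie in \<open>E\<close>, so solidity applies.
  This is why the blow-up is sought in the disc of radius \<open>pnorm x w + 1\<close>.\<close>

lemma class_in_E:
  assumes a: "a \<in> borel_measurable M" and le: "AE w in M. cmod (a w) \<le> pnorm x w + 1"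
  shows "L0_class M a \<in> E"
proof (rule solid)
  define b where "b = L0_add M (nrm x) (L0_const M 1)"
  show "L0_class M a \<in> L0 M" by (rule L0_class_in_L0[OF a])
  show b: "b \<in> E" unfolding b_def by (intro add_closed nrm_in const_in_E)
  have "AE w in M. cmod (rep b w) = pnorm x w + 1"
    using rep_add[OF nrm_in const_in_E, of x 1] rep_const[of 1] rep_nrm[of x] unfolding b_def
    by eventually_elim (simp flip: of_real_add add: abs_of_nonneg del: of_real_add)
  with le have "AE w in M. of_real (cmod (a w)) \<le> complex_of_real (cmod (rep b w))"
    by eventually_elim (simp add: less_eq_complex_def)
  then have "L0_le M (L0_abs M (L0_class M a)) (L0_abs M (L0_class M (rep b)))"
    using a E_rep_measurable[OF b] by (simp add: L0_ops_class)
  then show "L0_le M (L0_abs M (L0_class M a)) (L0_abs M b)"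
    using rep_L0(2)[OF E_L0[OF b]] by simp
qed

lemma ex_not_invertible:
  assumes M: "emeasure M (space M) \<noteq> 0"
  shows "\<exists>a\<in>E. \<not> invertible_wrt e (act a e - x)"
proof (rule ccontr)
  assume "\<not> ?thesis"
  then have inv: "\<exists>v. (act a e - x) * v = e \<and> v * (act a e - x) = e" if "a \<in> E" for a
    using that by (auto simp: invertible_wrt_def)
  then have "\<exists>v. (smult q e - x) * v = e \<and> v * (smult q e - x) = e" for q
    using const_in_E by (simp add: smult_def)
  then obtain R where R: "(smult q e - x) * R q = e" "R q * (smult q e - x) = e" for q
    by metis
  \<comment> \<open>The inverses of all \<open>q e - x\<close> with \<open>q\<close> in
    \<open>polar_rats\<close> are put into one countable algebra, so that a single null set serves
    the whole pointwise argument.\<close>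
  obtain C where C: "countable C" "insert e (insert x (R ` polar_rats)) \<subseteq> C"
    and closed: "\<And>f u v. f \<in> {(+), (*)} \<union> (\<lambda>q u v. smult q u) ` polar_rats \<Longrightarrow> u \<in> C \<Longrightarrow> v \<in> C \<Longrightarrow> f u v \<in> C"
    by (rule countable_closure[of "insert e (insert x (R ` polar_rats))"
          "{(+), (*)} \<union> (\<lambda>q u v. smult q u) ` polar_rats"])
       (use countable_polar_rats in auto)
  have "AE w in M. seminormed_algebra smult e C (\<lambda>u. pnorm u w)"
  proof (rule AE_seminormed_algebra)
    show "smult q u \<in> C" if "q \<in> polar_rats" "u \<in> C" for q u
      using closed[of "\<lambda>u v. smult q u" u u] that by blast
  qed (use C closed[of "(+)"] closed[of "(*)"] in auto)
  then have "AE w in M. \<forall>B. \<exists>q\<in>polar_rats. cmod q \<le> pnorm x w + 1 \<and> B < pnorm (R q) w"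
  proof eventually_elim
    case (elim w)
    show ?case
      using seminormed_algebra.resolvent_unbounded[OF elim, of x R] C(2) R by blast
  qed
  moreover have "polar_rats \<noteq> {}" using of_real_polar_rats[of 0] by auto
  ultimately obtain a where a: "a \<in> borel_measurable M"
    and blow: "AE w in M. \<forall>\<epsilon>>0. \<forall>B. \<exists>q\<in>polar_rats.
      cmod q \<le> pnorm x w + 1 \<and> cmod (q - a w) < \<epsilon> \<and> B < pnorm (R q) w"
    by (elim measurable_blow_up_point[OF countable_polar_rats, rotated 3, where f = "\<lambda>q. pnorm (R q)"]) auto
  have "AE w in M. cmod (a w) \<le> pnorm x w + 1"
    using blow
  proof eventually_elim
    case (elim w)
    show ?case
    proof (rule field_le_epsilon)
      fix \<epsilon> :: real assume "\<epsilon> > 0"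
      then obtain q where "cmod q \<le> pnorm x w + 1" "cmod (q - a w) < \<epsilon>" using elim by blast
      then show "cmod (a w) \<le> pnorm x w + 1 + \<epsilon>"
        using norm_triangle_ineq4[of q "q - a w"] by simp
    qed
  qed
  with a have aE: "L0_class M a \<in> E" by (rule class_in_E)
  then obtain r where r: "(act (L0_class M a) e - x) * r = e" using inv by blast
  have "AE w in M. \<forall>q\<in>polar_rats. pnorm (R q) w \<le> pnorm r w + cmod (q - a w) * (pnorm (R q) w * pnorm r w)"
    by (intro AE_ball_countable'[OF _ countable_polar_rats] resolvent_bound[OF a aE R(2) r])
  with blow rep_nrm[of r] have "AE w in M. False"
  proof eventually_elim
    case (elim w)
    define h where "h = pnorm r w"
    have h: "h \<ge> 0" using elim by (simp add: h_def)
    \<comment> \<open>The distance to \<open>a w\<close> is so small that the product term absorbs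
      at most half of \<open>pnorm (R q) w\<close>. This leaves
      \<open>pnorm (R q) w \<le> 2 * h\<close>, against the choice of \<open>q\<close>.\<close>
    then obtain q where q: "q \<in> polar_rats" "cmod (q - a w) < 1 / (2 * (h + 1))" "2 * h < pnorm (R q) w"
      using elim(1)[THEN spec, of "1 / (2 * (h + 1))"] by auto
    have N: "0 < pnorm (R q) w" using q h by linarith
    have "cmod (q - a w) * (h + 1) < 1 / 2" using q(2) h by (simp add: pos_less_divide_eq algebra_simps)
    then have "cmod (q - a w) * h \<le> 1 / 2" by (simp add: distrib_left) (smt (verit) norm_ge_zero)
    then have "cmod (q - a w) * h * pnorm (R q) w \<le> 1 / 2 * pnorm (R q) w"
      using N by (intro mult_right_mono) auto
    moreover have "pnorm (R q) w \<le> h + cmod (q - a w) * (pnorm (R q) w * h)"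
      using elim q(1) by (auto simp: h_def)
    ultimately show False using q(3) by (simp add: mult_ac)
  qed
  \<comment> \<open>A false statement holding almost everywhere would make the whole space
    null.\<close>
  then show False using M by (simp add: AE_iff_null null_sets_def)
qed

end

text \<open>The measure must be nonzero: over a null space \<open>L0 M\<close> has a single class,
  so every norm vanishes, the algebra is \<open>{0}\<close>, and its only element is
  invertible.\<close>

theorem proposition2p4:
  fixes M :: "'w measure" and E :: "('w \<Rightarrow> complex) set set"
    and scaleC :: "complex \<Rightarrow> 'u::ring \<Rightarrow> 'u"
    and nrm :: "'u \<Rightarrow> ('w \<Rightarrow> complex) set"
    and act :: "('w \<Rightarrow> complex) set \<Rightarrow> 'u \<Rightarrow> 'u"
    and e x :: 'u
  assumes "finite_measure M" and "emeasure M (space M) \<noteq> 0"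
    and "faithful_solid_subalgebra M E"
    and "unital_banach_kantorovich_algebra scaleC M E nrm act e"
  shows "sp E act e x \<noteq> {}"
proof -
  interpret unital_algebra_over_solid scaleC M E nrm act e
    using assms by (simp add: unital_algebra_over_solid_def)
  show ?thesis using ex_not_invertible[OF assms(2)] by (auto simp: sp_def)
qed

end
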